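(* Let $R$ be the ELT algebra with tangible values $F=(\mathbb{R},+)$ and layers $L=\mathbb{Q}$. In $R[\lambda_1,\lambda_2]$ put $$f_1=\lambda_2+\lambda_1+\lambda_1^2+(-1)\lambda_1^3,\qquad f_2=\lambda_2+0+\lambda_1^2+(-2)\lambda_1^4,$$ $$g_1=\lambda_2+\lambda_1+\lambda_1^2+(-2)\lambda_1^4,\qquad g_2=\lambda_2+0+\lambda_1^2+(-1)\lambda_1^3 .$$ Then $f_1,f_2,g_1,g_2$ are irreducible and $f_1f_2=g_1g_2$ (as functions $R^2\to R$); thus unique factorization fails in $R[\lambda_1,\lambda_2]$.
   Context: ELT algebra: $R=\{{}^{[\ell]}\lambda : \lambda\in F,\ \ell\in L\}$, here with $F=(\mathbb{R},+)$ (usual order) and $L=\mathbb{Q}$, with operations: ${}^{[\ell_1]}\lambda+{}^{[\ell_2]}\lambda={}^{[\ell_1+\ell_2]}\lambda$; ${}^{[\ell_1]}\lambda_1+{}^{[\ell_2]}\lambda_2={}^{[\ell_1]}\lambda_1$ if $\lambda_1>\lambda_2$ (and symmetrically); ${}^{[\ell_1]}\lambda_1\cdot{}^{[\ell_2]}\lambda_2={}^{[\ell_1\ell_2]}(\lambda_1+_F\lambda_2)$. A real number $c$ written without a layer denotes ${}^{[1]}c\in R$; thus the constants $0,-1,-2$ above are ${}^{[1]}0$ (the multiplicative identity of $R$), ${}^{[1]}(-1)$, ${}^{[1]}(-2)$, and a monomial without written coefficient has coefficient ${}^{[1]}0$. A polynomial in $R[\lambda_1,\dots,\lambda_n]$ is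 a function $R^n\to R$ of the form $\sum_{I\in G}a_I\lambda^I$ with $G\subseteq(\mathbb{N}\cup\{0\})^n$ finite and $a_I\in R$; two polynomials are equal iff they are equal as functions. A polynomial is irreducible if it is non-constant and is not a product of two non-constant polynomials. *)

theory Defs
  imports
    "HOL-Analysis.Finite_Cartesian_Product"
    "HOL-Library.Multiset"
    "HOL-Library.Function_Algebras"
begin

text \<open>
  \<open>Elt l v\<close> is the element with layer \<open>l\<close> and tangible value \<open>v\<close>.  The order is the one of the
  tangible values, and the product adds tangible values, so that the unit \<open>1\<close> is \<open>Elt 1 0\<close>.
  There is no element minus infinity, hence no neutral element of addition.
\<close>

datatype ('l, 'f) elt = Elt (layer: 'l) (tang: 'f)

instantiation elt :: (comm_ring_1, linordered_ab_group_add) "{comm_semiring, comm_monoid_mult}"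
begin

definition plus_elt :: "('a, 'b) elt \<Rightarrow> ('a, 'b) elt \<Rightarrow> ('a, 'b) elt" where
  "x + y =
     (if tang x > tang y then x
      else if tang x < tang y then y
      else Elt (layer x + layer y) (tang x))"

definition times_elt :: "('a, 'b) elt \<Rightarrow> ('a, 'b) elt \<Rightarrow> ('a, 'b) elt" where
  "x * y = Elt (layer x * layer y) (tang x + tang y)"

definition one_elt :: "('a, 'b) elt" where
  "1 = Elt 1 0"

instance
proof
  fix x y z :: "('a, 'b) elt"
  show "x + y + z = x + (y + z)"
    by (auto simp: plus_elt_def add.assoc)
  show "x + y = y + x"
    by (cases x; cases y) (auto simp: plus_elt_def add.commute)
  show "x * y * z = x * (y * z)"
    by (simp add: times_elt_def ac_simps)
  show "x * y = y * x"
    by (simp add: times_elt_def ac_simps)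
  show "(x + y) * z = x * z + y * z"
    by (auto simp: plus_elt_def times_elt_def distrib_right)
  show "1 * x = x"
    by (simp add: times_elt_def one_elt_def)
qed

end

text \<open>A tangible value written without a layer.\<close>

definition unlayered :: "'f \<Rightarrow> ('l::one, 'f) elt" where
  "unlayered c = Elt 1 c"

text \<open>
  The library's \<open>sum\<close> needs a zero.  In an additive semigroup only nonempty finite sums exist;
  \<open>None\<close> plays the role of the missing zero.  The two lemmas determine the value on all finite
  nonempty sets; on other sets it is irrelevant.
\<close>

definition sum1 :: "('i \<Rightarrow> 'a::ab_semigroup_add) \<Rightarrow> 'i set \<Rightarrow> 'a" where
  "sum1 g A = the (Finite_Set.fold
     (\<lambda>i s. Some (case s of None \<Rightarrow> g i | Some t \<Rightarrow> g i + t)) None A)"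

lemma sum1_fold_commute:
  "comp_fun_commute_on UNIV
     (\<lambda>i s. Some (case s of None \<Rightarrow> (g i :: 'a::ab_semigroup_add) | Some t \<Rightarrow> g i + t))"
  by unfold_locales (auto simp: fun_eq_iff ac_simps split: option.splits)

lemma sum1_singleton: "sum1 g {i} = g i"
proof -
  interpret comp_fun_commute_on UNIV
    "\<lambda>i s. Some (case s of None \<Rightarrow> g i | Some t \<Rightarrow> g i + t)"
    by (rule sum1_fold_commute)
  show ?thesis
    by (simp add: sum1_def)
qed

lemma sum1_insert:
  assumes "finite A" "A \<noteq> {}" "i \<notin> A"
  shows "sum1 g (insert i A) = g i + sum1 g A"
proof -
  interpret comp_fun_commute_on UNIV
    "\<lambda>i s. Some (case s of None \<Rightarrow> g i | Some t \<Rightarrow> g i + t)"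
    by (rule sum1_fold_commute)
  obtain j B where "A = insert j B" "j \<notin> B"
    using assms(2) by (meson mk_disjoint_insert all_not_in_conv)
  with assms show ?thesis
    by (simp add: sum1_def)
qed

text \<open>
  Polynomials are functions, so equality of polynomials is equality of functions; their product
  is the pointwise one.
\<close>

definition polynomials ::
  "(('l::comm_ring_1, 'f::linordered_ab_group_add) elt ^ 'n \<Rightarrow> ('l, 'f) elt) set" where
  "polynomials =
     {p. \<exists>(G :: (nat ^ 'n) set) a. finite G \<and> G \<noteq> {} \<and>
           p = (\<lambda>x. sum1 (\<lambda>I. a I * (\<Prod>i\<in>UNIV. (x $ i) ^ (I $ i))) G)}"

definition constant_fun :: "('x \<Rightarrow> 'a) \<Rightarrow> bool" where
  "constant_fun p \<longleftrightarrow> (\<exists>c. p = (\<lambda>x. c))"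

text \<open>
  Every constant counts as a trivial factor here, also the non-invertible ones (those whose layer
  is not a unit).
\<close>

definition irreducible_in :: "('x \<Rightarrow> 'a::comm_monoid_mult) set \<Rightarrow> ('x \<Rightarrow> 'a) \<Rightarrow> bool" where
  "irreducible_in P p \<longleftrightarrow>
     p \<in> P \<and> \<not> constant_fun p \<and>
     \<not> (\<exists>q\<in>P. \<exists>r\<in>P. \<not> constant_fun q \<and> \<not> constant_fun r \<and> p = q * r)"

text \<open>
  Since irreducibility ignores all constants, factors are compared up to arbitrary constants on
  either side.  This relation is coarser than being associated via an invertible constant, so
  the failure of the following property is the stronger one.
\<close>

definition equal_upto_constants :: "('x \<Rightarrow> 'a::comm_monoid_mult) \<Rightarrow> ('x \<Rightarrow> 'a) \<Rightarrow> bool" where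
  "equal_upto_constants p q \<longleftrightarrow> (\<exists>a b. (\<lambda>x. a * p x) = (\<lambda>x. b * q x))"

text \<open>
  Uniqueness only: any two factorizations of the same function into irreducibles agree up to
  order and constants.  Existence of factorizations is left out, so that the property cannot
  fail merely for lack of a factorization.
\<close>

definition unique_factorization :: "('x \<Rightarrow> 'a::comm_monoid_mult) set \<Rightarrow> bool" where
  "unique_factorization P \<longleftrightarrow>
     (\<forall>F G. (\<forall>p\<in>#F. irreducible_in P p) \<and> (\<forall>q\<in>#G. irreducible_in P q) \<and>
            prod_mset F = prod_mset G \<longrightarrow> rel_mset equal_upto_constants F G)"

end

theory Submission imports Defs "HOL-Analysis.Cartesian_Space" begin

text \<open>
  Irreducibility depends only on the tangible values.  If \<open>x $ 2 + h (x $ 1) = q * r\<close>, one factor,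
  say \<open>q\<close>, has a monomial involving \<open>x $ 2\<close>.  Whatever the tangible value \<open>s\<close> of \<open>x $ 1\<close>, the
  product has tangible value \<open>t\<close> as soon as the tangible value \<open>t\<close> of \<open>x $ 2\<close> is large.  Since
  exponents are nonnegative, a nonconstant monomial in \<open>r\<close> would make the product exceed \<open>t\<close> for
  large \<open>s\<close> and \<open>t\<close>; so \<open>r\<close> is constant.

  Write the four polynomials with \<open>a = x\<close>, \<open>a' = 0\<close>, \<open>b = x\<^sup>2\<close>, \<open>c = (-1) x\<^sup>3\<close>, \<open>c' = (-2) x\<^sup>4\<close>.  The
  expansions of \<open>f1 * f2\<close> and \<open>g1 * g2\<close> differ only in \<open>a c' + c a'\<close> against \<open>a c + c' a'\<close>, and
  each of these four terms is everywhere strictly dominated by \<open>a a'\<close>, \<open>b\<^sup>2\<close> or \<open>c c'\<close>.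
\<close>

section \<open>Tangible values and finite sums\<close>

lemma tang_plus: "tang (u + v) = max (tang u) (tang v)"
  by (auto simp: plus_elt_def)

lemma tang_le_plusI1: "tang w \<le> tang u \<Longrightarrow> tang w \<le> tang (u + v)"
  and tang_le_plusI2: "tang w \<le> tang v \<Longrightarrow> tang w \<le> tang (u + v)"
  by (simp_all add: tang_plus le_max_iff_disj)

lemma tang_times: "tang (u * v) = tang u + tang v"
  by (simp add: times_elt_def)

lemma tang_power: "tang (u ^ n) = real n * tang u"
  for u :: "('l::comm_ring_1, real) elt"
  by (induction n) (simp_all add: tang_times one_elt_def algebra_simps)

lemma tang_unlayered [simp]: "tang (unlayered c) = c"
  by (simp add: unlayered_def)

lemma plus_absorb: "tang v < tang u \<Longrightarrow> u + v = u"
  by (simp add: plus_elt_def)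

lemma tang_sum1_ge:
  assumes "finite A" "i \<in> A"
  shows "tang (g i) \<le> tang (sum1 g A)"
  using assms
proof (induction A)
  case (insert j A)
  show ?case
  proof (cases "A = {}")
    case True
    with insert.prems show ?thesis
      by (simp add: sum1_singleton)
  next
    case False
    with insert show ?thesis
      by (auto simp: sum1_insert tang_plus max_def)
  qed
qed simp

lemma sum1_cong:
  assumes "finite A" "\<And>i. i \<in> A \<Longrightarrow> g i = h i"
  shows "sum1 g A = sum1 h A"
  using assms
proof (induction A)
  case (insert j A)
  then show ?case
    by (cases "A = {}") (auto simp: sum1_singleton sum1_insert)
qed (simp add: sum1_def)

section \<open>Polynomial functions in two variables\<close>

lemma prod_UNIV_2: "(\<Prod>i\<in>UNIV. g i) = g 1 * g (2 :: 2)"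
  by (simp add: UNIV_2)

lemma nat_vec_2_eq_iff: "u = v \<longleftrightarrow> u $ 1 = v $ 1 \<and> u $ 2 = v $ 2" for u v :: "'a ^ 2"
  by (simp add: vec_eq_iff forall_2)

definition point :: "real \<Rightarrow> real \<Rightarrow> ('l::one, real) elt ^ 2" where
  "point s t = (\<chi> i. if i = 1 then unlayered s else unlayered t)"

lemma point_nth [simp]: "point s t $ 1 = unlayered s" "point s t $ 2 = unlayered t"
  by (simp_all add: point_def)

definition poly_fun :: "(nat ^ 2 \<Rightarrow> ('l::comm_ring_1, real) elt) \<Rightarrow> (nat ^ 2) set \<Rightarrow>
    ('l, real) elt ^ 2 \<Rightarrow> ('l, real) elt" where
  "poly_fun a G x = sum1 (\<lambda>I. a I * (\<Prod>i\<in>UNIV. (x $ i) ^ (I $ i))) G"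

lemma polynomials_eq_poly_fun:
  "polynomials = {p. \<exists>G a. finite G \<and> G \<noteq> {} \<and> p = poly_fun a G}"
  by (simp add: polynomials_def poly_fun_def [abs_def])

text \<open>Addition takes the maximum of tangible values, so each monomial is a lower bound,
  whatever the layers are.\<close>

lemma tang_poly_fun_ge:
  assumes "finite G" "I \<in> G"
  shows "tang (a I) + real (I $ 1) * s + real (I $ 2) * t \<le> tang (poly_fun a G (point s t))"
  using tang_sum1_ge [OF assms, of "\<lambda>I. a I * (\<Prod>i\<in>UNIV. (point s t $ i) ^ (I $ i))"]
  by (simp add: poly_fun_def prod_UNIV_2 tang_times tang_power add.assoc)

lemma poly_fun_const_in_snd:
  assumes "finite G" "\<And>I. I \<in> G \<Longrightarrow> I $ 2 = 0" "x $ 1 = y $ 1"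
  shows "poly_fun a G x = poly_fun a G y"
  unfolding poly_fun_def using assms by (intro sum1_cong) (auto simp: prod_UNIV_2)

lemma constant_poly_fun:
  assumes "finite G" "\<And>I. I \<in> G \<Longrightarrow> I = 0"
  shows "constant_fun (poly_fun a G)"
  unfolding constant_fun_def
proof (intro exI ext)
  fix x
  show "poly_fun a G x = poly_fun a G undefined"
    unfolding poly_fun_def using assms(1)
  proof (rule sum1_cong)
    fix I
    assume "I \<in> G"
    then have "I = 0"
      by (rule assms(2))
    then show "a I * (\<Prod>i\<in>UNIV. (x $ i) ^ (I $ i)) = a I * (\<Prod>i\<in>UNIV. (undefined $ i) ^ (I $ i))"
      by simp
  qed
qed

section \<open>Irreducibility\<close>

lemma second_factor_exponent_zero:
  assumes fact: "(\<lambda>x. x $ 2 + h (x $ 1)) = poly_fun a G * poly_fun b H"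
    and fin: "finite G" "finite H"
    and J: "J \<in> G" "J $ 2 \<noteq> 0" and I: "I \<in> H"
  shows "I = 0"
proof (rule ccontr)
  assume "I \<noteq> 0"
  then have I_pos: "I $ 1 \<ge> 1 \<or> I $ 2 \<ge> 1"
    by (auto simp: nat_vec_2_eq_iff)
  define c where "c = tang (a J) + tang (b I)"
  \<comment> \<open>Both \<open>s\<close> and \<open>t\<close> exceed \<open>- c\<close>, so one
    extra \<open>s\<close> or \<open>t\<close> outweighs the coefficients. The choice of
    \<open>t\<close> also makes \<open>x $ 2\<close> dominate \<open>h (x $ 1)\<close>.\<close>
  define s where "s = \<bar>c\<bar> + 1"
  define t where "t = max s (tang (h (unlayered s)) + 1)"
  have "t = tang (unlayered t + h (unlayered s))"
    by (simp add: tang_plus t_def max_def)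
  also have "\<dots> = tang (poly_fun a G (point s t)) + tang (poly_fun b H (point s t))"
    using fun_cong [OF fact, of "point s t"] by (simp add: tang_times)
  also have "\<dots> \<ge> c + real (J $ 1) * s + real (J $ 2) * t + real (I $ 1) * s + real (I $ 2) * t"
    using tang_poly_fun_ge [OF fin(1) J(1), of a s t] tang_poly_fun_ge [OF fin(2) I, of b s t]
    by (simp add: c_def)
  finally have le:
    "c + real (J $ 1) * s + real (J $ 2) * t + real (I $ 1) * s + real (I $ 2) * t \<le> t" .
  have s: "s > 0" "s > - c" and t: "t \<ge> s"
    by (auto simp: s_def t_def)
  have nonneg: "real (J $ 1) * s \<ge> 0" "real (I $ 1) * s \<ge> 0" "real (I $ 2) * t \<ge> 0"
    using s t by simp_all
  \<comment> \<open>The monomial \<open>J\<close> alone uses up all of \<open>t\<close>, leaving no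
    room for \<open>c\<close> plus a contribution of \<open>I\<close>.\<close>
  have Jt: "real (J $ 2) * t \<ge> t"
    using mult_right_mono [of 1 "real (J $ 2)" t] J(2) s t by simp
  from I_pos show False
  proof
    assume "I $ 1 \<ge> 1"
    then have "real (I $ 1) * s \<ge> s"
      using mult_right_mono [of 1 "real (I $ 1)" s] s by simp
    with le s nonneg Jt show False by linarith
  next
    assume "I $ 2 \<ge> 1"
    then have "real (I $ 2) * t \<ge> t"
      using mult_right_mono [of 1 "real (I $ 2)" t] s t by simp
    with le s t nonneg Jt show False by linarith
  qed
qed

lemma irreducible_snd_plus:
  fixes h :: "('l::comm_ring_1, real) elt \<Rightarrow> ('l, real) elt"
  assumes "(\<lambda>x :: ('l, real) elt ^ 2. x $ 2 + h (x $ 1)) \<in> polynomials"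
  shows "irreducible_in polynomials (\<lambda>x :: ('l, real) elt ^ 2. x $ 2 + h (x $ 1))" (is "irreducible_in _ ?f")
proof -
  \<comment> \<open>With this \<open>t\<close> the second coordinate dominates, so \<open>?f\<close>
    has tangible values \<open>t\<close> and \<open>t + 1\<close> at the two points below.\<close>
  define t where "t = tang (h (unlayered 0)) + 1"
  have vary: "?f (point 0 t) \<noteq> ?f (point 0 (t + 1))"
  proof
    assume "?f (point 0 t) = ?f (point 0 (t + 1))"
    then have "tang (?f (point 0 t)) = tang (?f (point 0 (t + 1)))"
      by (rule arg_cong)
    then show False
      by (simp add: tang_plus t_def)
  qed
  have "constant_fun q \<or> constant_fun r"
    if q: "q \<in> polynomials" and r: "r \<in> polynomials" and f: "?f = q * r" for q r
  proof -
    obtain a G b H where fin: "finite G" "finite H" and qr: "q = poly_fun a G" "r = poly_fun b H"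
      using q r by (auto simp: polynomials_eq_poly_fun)
    note fact = f [unfolded qr]
    \<comment> \<open>Otherwise neither factor depends on the second coordinate, against
      \<open>vary\<close>.\<close>
    have "\<exists>J\<in>G \<union> H. J $ 2 \<noteq> 0"
    proof (rule ccontr)
      assume "\<not> ?thesis"
      then have "poly_fun a G (point 0 t) = poly_fun a G (point 0 (t + 1))"
        "poly_fun b H (point 0 t) = poly_fun b H (point 0 (t + 1))"
        using fin by (auto intro!: poly_fun_const_in_snd)
      then have "(poly_fun a G * poly_fun b H) (point 0 t) =
          (poly_fun a G * poly_fun b H) (point 0 (t + 1))"
        by simp
      then show False
        using vary unfolding fact [symmetric] by contradiction
    qed
    then consider J where "J \<in> G" "J $ 2 \<noteq> 0" | J where "J \<in> H" "J $ 2 \<noteq> 0"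
      by blast
    then show ?thesis
    proof cases
      case 1
      have "constant_fun r"
        unfolding qr using fin(2) second_factor_exponent_zero [OF fact fin 1]
        by (rule constant_poly_fun)
      then show ?thesis ..
    next
      case 2
      have "?f = poly_fun b H * poly_fun a G"
        unfolding fact by (rule mult.commute)
      from second_factor_exponent_zero [OF this fin(2) fin(1) 2] have "constant_fun q"
        unfolding qr by (rule constant_poly_fun [OF fin(1)])
      then show ?thesis ..
    qed
  qed
  moreover have "\<not> constant_fun ?f"
    unfolding constant_fun_def
  proof
    assume "\<exists>c. ?f = (\<lambda>x. c)"
    then obtain c where "?f = (\<lambda>x. c)"
      by blast
    from fun_cong [OF this, of "point 0 t"] fun_cong [OF this, of "point 0 (t + 1)"] vary
    show False
      by metis
  qed
  ultimately show ?thesis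
    using assms by (auto simp: irreducible_in_def)
qed

lemma snd_plus_trinomial_in_polynomials:
  fixes c1 c2 c3 :: "('l::comm_ring_1, real) elt"
  assumes "distinct [m1, m2, m3]"
  shows "(\<lambda>x :: ('l, real) elt ^ 2.
    x $ 2 + (c1 * (x $ 1) ^ m1 + c2 * (x $ 1) ^ m2 + c3 * (x $ 1) ^ m3)) \<in> polynomials"
proof -
  define e :: "nat \<Rightarrow> nat \<Rightarrow> nat ^ 2" where "e m n = (\<chi> i. if i = 1 then m else n)" for m n
  have e_nth [simp]: "e m n $ 1 = m" "e m n $ 2 = n" for m n
    by (simp_all add: e_def)
  have e_eq [simp]: "e m n = e m' n' \<longleftrightarrow> m = m' \<and> n = n'" for m n m' n'
    by (simp add: nat_vec_2_eq_iff)
  \<comment> \<open>Distinct exponents keep these four vectors distinct, so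
    \<open>sum1_insert\<close> splits the sum and \<open>a\<close> gives each monomial its own
    coefficient.\<close>
  define G where "G = {e 0 1, e m1 0, e m2 0, e m3 0}"
  define a where "a I = (if I = e 0 1 then 1 else if I = e m1 0 then c1
      else if I = e m2 0 then c2 else c3)" for I
  have "x $ 2 + (c1 * (x $ 1) ^ m1 + c2 * (x $ 1) ^ m2 + c3 * (x $ 1) ^ m3) = poly_fun a G x"
    for x :: "('l, real) elt ^ 2"
    using assms by (simp add: poly_fun_def G_def sum1_insert sum1_singleton prod_UNIV_2 a_def add.assoc)
  then show ?thesis
    unfolding polynomials_eq_poly_fun by (auto simp: G_def fun_eq_iff intro!: exI [of _ G])
qed

lemma irreducible_snd_plus_trinomial:
  fixes c1 c2 c3 :: "('l::comm_ring_1, real) elt"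
  assumes "distinct [m1, m2, m3]"
  shows "irreducible_in polynomials
    (\<lambda>x :: ('l, real) elt ^ 2. x $ 2 + c1 * (x $ 1) ^ m1 + c2 * (x $ 1) ^ m2 + c3 * (x $ 1) ^ m3)"
  using irreducible_snd_plus [OF snd_plus_trinomial_in_polynomials [OF assms, of c1 c2 c3]]
  by (simp add: add.assoc)

section \<open>Two factorizations of one product\<close>

lemma product_swap:
  fixes x y :: "('l::comm_ring_1, real) elt"
  shows "(y + x + x ^ 2 + unlayered (-1) * x ^ 3) *
      (y + unlayered 0 + x ^ 2 + unlayered (-2) * x ^ 4) =
    (y + x + x ^ 2 + unlayered (-2) * x ^ 4) *
      (y + unlayered 0 + x ^ 2 + unlayered (-1) * x ^ 3)"
proof -
  define a' :: "('l, real) elt" where "a' = unlayered 0"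
  define b where "b = x ^ 2"
  define c where "c = unlayered (-1) * x ^ 3"
  define c' where "c' = unlayered (-2) * x ^ 4"
  \<comment> \<open>The fourteen terms common to both expansions. \<open>y * b\<close> is listed
    twice because equal terms add their layers.\<close>
  define S where "S = y * y + y * x + y * b + y * c + y * a' + y * b + y * c' +
    x * a' + x * b + b * a' + b * b + b * c + b * c' + c * c'"
  have tangs: "tang a' = 0" "tang b = 2 * tang x" "tang c = 3 * tang x - 1" "tang c' = 4 * tang x - 2"
    by (simp_all add: a'_def b_def c_def c'_def tang_times tang_power)
  have "tang S \<ge> tang (x * a')" "tang S \<ge> tang (b * b)" "tang S \<ge> tang (c * c')"
    unfolding S_def by (blast intro: tang_le_plusI1 tang_le_plusI2)+
  then have "tang S \<ge> tang x" "tang S \<ge> 4 * tang x" "tang S \<ge> 7 * tang x - 3"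
    by (simp_all add: tang_times tangs)
  \<comment> \<open>Let X be \<open>tang x\<close>. The four terms have values 5X-2, 3X-1, 4X-1 and
    4X-2. The last two lie below 4X; 3X-1 lies below X if X < 1/2 and below 4X otherwise; 5X-2 lies
    below 4X if X < 2 and below 7X-3 otherwise.\<close>
  then have "tang (x * c' + c * a') < tang S" "tang (x * c + c' * a') < tang S"
    by (simp_all add: tang_plus tang_times tangs)
  then have "S + (x * c' + c * a') = S + (x * c + c' * a')"
    by (simp add: plus_absorb)
  moreover have "(y + x + b + c) * (y + a' + b + c') = S + (x * c' + c * a')"
    by (simp add: S_def algebra_simps)
  moreover have "(y + x + b + c') * (y + a' + b + c) = S + (x * c + c' * a')"
    by (simp add: S_def algebra_simps)
  ultimately show ?thesis
    by (simp add: a'_def b_def c_def c'_def)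
qed

text \<open>Constants only shift tangible values, so functions equal up to constants have a constant
  difference of tangible values; here it is zero at \<open>u\<close> but not at
  \<open>v\<close>.\<close>

lemma not_equal_upto_constants:
  fixes p q :: "'x \<Rightarrow> ('l::comm_ring_1, real) elt"
  assumes "tang (p u) = tang (q u)" "tang (p v) \<noteq> tang (q v)"
  shows "\<not> equal_upto_constants p q"
proof
  assume "equal_upto_constants p q"
  then obtain a b where "a * p x = b * q x" for x
    unfolding equal_upto_constants_def fun_eq_iff by blast
  then have "tang a + tang (p x) = tang b + tang (q x)" for x
    by (metis tang_times)
  from this [of u] this [of v] assms show False
    by simp
qed

lemma rel_mset_memberD:
  assumes "rel_mset R M N" "x \<in># M"
  shows "\<exists>y\<in>#N. R x y"
  using multi_member_split [OF assms(2)] assms(1) by (auto dest: msed_rel_invL)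

theorem mainTheorem3:
  fixes f1 f2 g1 g2 :: "(rat, real) elt ^ 2 \<Rightarrow> (rat, real) elt"
  assumes f1: "f1 = (\<lambda>x. x $ 2 + x $ 1 + (x $ 1) ^ 2 + unlayered (-1) * (x $ 1) ^ 3)"
    and f2: "f2 = (\<lambda>x. x $ 2 + unlayered 0 + (x $ 1) ^ 2 + unlayered (-2) * (x $ 1) ^ 4)"
    and g1: "g1 = (\<lambda>x. x $ 2 + x $ 1 + (x $ 1) ^ 2 + unlayered (-2) * (x $ 1) ^ 4)"
    and g2: "g2 = (\<lambda>x. x $ 2 + unlayered 0 + (x $ 1) ^ 2 + unlayered (-1) * (x $ 1) ^ 3)"
  shows "irreducible_in polynomials f1 \<and> irreducible_in polynomials f2 \<and>
         irreducible_in polynomials g1 \<and> irreducible_in polynomials g2 \<and>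
         f1 * f2 = g1 * g2 \<and>
         \<not> unique_factorization
             (polynomials :: ((rat, real) elt ^ 2 \<Rightarrow> (rat, real) elt) set)"
proof -
  have irr: "irreducible_in polynomials f1" "irreducible_in polynomials f2"
    "irreducible_in polynomials g1" "irreducible_in polynomials g2"
    using irreducible_snd_plus_trinomial [of 1 2 3 1 1 "unlayered (-1) :: (rat, real) elt"]
      irreducible_snd_plus_trinomial [of 0 2 4 "unlayered 0" 1 "unlayered (-2) :: (rat, real) elt"]
      irreducible_snd_plus_trinomial [of 1 2 4 1 1 "unlayered (-2) :: (rat, real) elt"]
      irreducible_snd_plus_trinomial [of 0 2 3 "unlayered 0" 1 "unlayered (-1) :: (rat, real) elt"]
    by (simp_all add: f1 f2 g1 g2)
  have prod: "f1 * f2 = g1 * g2"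
    by (simp add: f1 f2 g1 g2 fun_eq_iff product_swap)
  \<comment> \<open>At \<open>point 0 10\<close> all of \<open>f1\<close>, \<open>g1\<close>,
    \<open>g2\<close> have tangible value 10. At \<open>point 2 0\<close> the top terms decide: 5
    for \<open>f1\<close>, 6 for \<open>g1\<close>.\<close>
  have "\<not> equal_upto_constants f1 g1"
    by (rule not_equal_upto_constants [of _ "point 0 10" _ "point 2 0"])
      (simp_all add: f1 g1 tang_plus tang_times tang_power)
  \<comment> \<open>Here the low terms decide: -1 for \<open>f1\<close>, 0 for
    \<open>g2\<close>.\<close>
  moreover have "\<not> equal_upto_constants f1 g2"
    by (rule not_equal_upto_constants [of _ "point 0 10" _ "point (-1) (-5)"])
      (simp_all add: f1 g2 tang_plus tang_times tang_power)
  \<comment> \<open>Any matching would pair \<open>f1\<close> with \<open>g1\<close> or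
    \<open>g2\<close>.\<close>
  ultimately have "\<not> rel_mset equal_upto_constants {#f1, f2#} {#g1, g2#}"
    using rel_mset_memberD [of equal_upto_constants "{#f1, f2#}" "{#g1, g2#}" f1] by auto
  moreover have "prod_mset {#f1, f2#} = prod_mset {#g1, g2#}"
    using prod by simp
  ultimately have "\<not> unique_factorization
      (polynomials :: ((rat, real) elt ^ 2 \<Rightarrow> (rat, real) elt) set)"
    using irr unfolding unique_factorization_def
    by (intro notI, elim allE [of _ "{#f1, f2#}"] allE [of _ "{#g1, g2#}"]) simp
  with irr prod show ?thesis
    by blast
qed

end
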